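(* There exists a sequence $(G_i)_{i\in\mathbb{N}}$ of graphs such that $\chi^{\ell}_{\mathrm{fan},2}(G_i)\le 2$ and $\mathrm{col}_{\mathrm{fan},i}(G_i)\ge i+1$ for every positive integer $i$.
   Context: Graphs are finite and simple. A fan is a graph consisting of a path and another vertex adjacent to all vertices of the path (a path may have a single vertex, so a single edge is a fan on two vertices). For a graph $G$, $\mathrm{fan}(G)$ is the maximum number of vertices of a fan appearing in $G$ as a (not necessarily induced) subgraph; by convention $\mathrm{fan}(G)=1$ if $G$ is non-null and has no edges, and $\mathrm{fan}(G)=0$ for the null graph. Below, $f$ denotes a graph parameter (here $f=\mathrm{fan}$). A list assignment $L$ for $G$ assigns to each vertex a set of colors; it is an $s$-list assignment if $|L(v)|\ge s$ for each $v\in V(G)$. An $L$-coloring is a map $\varphi$ on $V(G)$ with $\varphi(v)\in L(v)$ for every $v$ (adjacent vertices may receive the same color). A coloring $\varphi$ of $G$ is $(f,p)$-proper if $f(G[\varphi^{-1}(c)])\le p$ for each color $c$ used by $\varphi$. $\chi^{\ell}_{f,p}(G)$ is the least non-negative integer $s$ such that $G$ has an $(f,p)$-proper $L$-coloring for every $s$-list assignment $L$ of $G$ (and $\infty$ if no such $s$ exists). For a positive integer $s$, an $s$-island in a graph $G$ is a non-empty set $I\subseteq V(G)$ such that each vertex in $I$ has less than $s$ neighbors in $G$ not belonging to $I$. $\mathrm{col}_{f,p}(G)$ is the least positive integer $s$ such that every non-null induced subgraph $H$ of $G$ contains an $s$-island $I$ (of $H$) satisfying $f(H[I])\le p$ (and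 $\infty$ if no such $s$ exists). *)

theory Defs
  imports "Graph_Theory.Digraph_Component" "HOL-Library.Extended_Nat"
begin

text \<open>
  Finite simple graphs are rendered by the locale predicate \<^const>\<open>graph\<close>: finite symmetric
  digraphs without loops or parallel arcs, an undirected edge being a pair of opposite arcs.
  Hence a subgraph in the undirected sense is a \<^const>\<open>subgraph\<close> that again satisfies
  \<^const>\<open>graph\<close>, while an \<^const>\<open>induced_subgraph\<close> of a graph is automatically one.
\<close>

definition is_fan :: "('a,'b) pre_digraph \<Rightarrow> bool" where
  "is_fan F \<longleftrightarrow> graph F \<and>
     (\<exists>c p. p \<noteq> [] \<and> distinct (c # p) \<and> verts F = set (c # p) \<and>
        (let E = set (zip p (tl p)) \<union> {c} \<times> set p in arcs_ends F = E \<union> E\<inverse>))"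

definition fan :: "('a,'b) pre_digraph \<Rightarrow> nat" where
  "fan G = (if verts G = {} then 0
            else if arcs G = {} then 1
            else Max {card (verts F) | F. is_fan F \<and> subgraph F G})"

text \<open>
  The maximum above ranges over a finite set, which is non-empty as soon as there is an edge.
\<close>

lemma finite_fan_sizes:
  assumes "graph G"
  shows "finite {card (verts F) | F. is_fan F \<and> subgraph F G}"
proof -
  interpret graph G by fact
  have "{card (verts F) | F. is_fan F \<and> subgraph F G} \<subseteq> {..card (verts G)}"
    by (auto simp: subgraph_def intro: card_mono)
  then show ?thesis by (rule finite_subset) simp
qed

lemma fan_sizes_nonempty:
  assumes "graph G" and "arcs G \<noteq> {}"
  shows "2 \<in> {card (verts F) | F. is_fan F \<and> subgraph F G}"
proof -
  interpret graph G by fact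
  obtain e where e: "e \<in> arcs G" using assms(2) by blast
  have "symmetric G" by (rule sym_arcs)
  then obtain e' where e': "e' \<in> arcs G" "tail G e = head G e'" "head G e = tail G e'"
    using e unfolding symmetric_conv by blast
  let ?F = "\<lparr>verts = {tail G e, head G e}, arcs = {e, e'}, tail = tail G, head = head G\<rparr>"
  have ne: "tail G e \<noteq> head G e" using e no_loops by blast
  have "wf_digraph ?F" using e' by unfold_locales auto
  have "graph ?F"
    using e e' ne no_multi_arcs
    by unfold_locales (auto simp: symmetric_conv arc_to_ends_def)
  moreover have "arcs_ends ?F = {(tail G e, head G e), (head G e, tail G e)}"
    using e' by (auto simp: arcs_ends_conv)
  ultimately have "is_fan ?F"
    unfolding is_fan_def using ne
    by (intro conjI exI[of _ "tail G e"] exI[of _ "[head G e]"]) (auto simp: Let_def)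
  moreover have "subgraph ?F G"
    using e e' \<open>wf_digraph ?F\<close> wf_digraph by (auto simp: subgraph_def compatible_def)
  moreover have "card (verts ?F) = 2" using ne by simp
  ultimately show ?thesis by (metis (mono_tags, lifting) mem_Collect_eq)
qed

text \<open>
  Colors are natural numbers. On a finite graph this is no restriction: every list can be shrunk
  to a finite one, after which only finitely many colors occur. Lists may be infinite, and
  \<^const>\<open>card\<close> is 0 on infinite sets, so these are admitted separately.
\<close>

definition list_assignment :: "('a,'b) pre_digraph \<Rightarrow> nat \<Rightarrow> ('a \<Rightarrow> nat set) \<Rightarrow> bool" where
  "list_assignment G s L \<longleftrightarrow> (\<forall>v \<in> verts G. infinite (L v) \<or> s \<le> card (L v))"

definition list_coloring :: "('a,'b) pre_digraph \<Rightarrow> ('a \<Rightarrow> nat set) \<Rightarrow> ('a \<Rightarrow> nat) \<Rightarrow> bool" where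
  "list_coloring G L \<phi> \<longleftrightarrow> (\<forall>v \<in> verts G. \<phi> v \<in> L v)"

definition proper_wrt ::
  "(('a,'b) pre_digraph \<Rightarrow> nat) \<Rightarrow> nat \<Rightarrow> ('a,'b) pre_digraph \<Rightarrow> ('a \<Rightarrow> nat) \<Rightarrow> bool" where
  "proper_wrt f p G \<phi> \<longleftrightarrow> (\<forall>c \<in> \<phi> ` verts G. f (G \<restriction> {v \<in> verts G. \<phi> v = c}) \<le> p)"

text \<open>In \<^typ>\<open>enat\<close>, the infimum of a non-empty set is its least element, and that of the
  empty set is \<open>\<infinity>\<close>.\<close>

definition choice_number ::
  "(('a,'b) pre_digraph \<Rightarrow> nat) \<Rightarrow> nat \<Rightarrow> ('a,'b) pre_digraph \<Rightarrow> enat" where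
  "choice_number f p G =
     Inf {enat s | s. \<forall>L. list_assignment G s L \<longrightarrow>
                        (\<exists>\<phi>. list_coloring G L \<phi> \<and> proper_wrt f p G \<phi>)}"

definition island :: "nat \<Rightarrow> ('a,'b) pre_digraph \<Rightarrow> 'a set \<Rightarrow> bool" where
  "island s G I \<longleftrightarrow> I \<noteq> {} \<and> I \<subseteq> verts G \<and>
     (\<forall>v \<in> I. card {w \<in> verts G - I. v \<rightarrow>\<^bsub>G\<^esub> w} < s)"

definition coloring_number ::
  "(('a,'b) pre_digraph \<Rightarrow> nat) \<Rightarrow> nat \<Rightarrow> ('a,'b) pre_digraph \<Rightarrow> enat" where
  "coloring_number f p G =
     Inf {enat s | s. 0 < s \<and>
            (\<forall>H. induced_subgraph H G \<and> verts H \<noteq> {} \<longrightarrow>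
                 (\<exists>I. island s H I \<and> f (H \<restriction> I) \<le> p))}"

end

theory Submission
  imports Defs
begin

text \<open>
  The graph \<open>G\<^sub>i\<close> is the join of two paths on \<open>i\<^sup>2\<close> vertices each.

  A graph without triangles has no fan on three or more vertices, so a coloring is
  \<open>(fan, 2)\<close>-proper as soon as no triangle is monochromatic (\<open>fan_le_2_if_triangle_free\<close>). Every
  triangle of the join has two of its vertices on the same side, hence contains an edge of one of
  the two paths. It is therefore enough to color the two paths properly, without any
  regard to the edges between them, and greedily this can be done from lists of size two.

  On the other hand, let \<open>v\<close> be a vertex of an \<open>i\<close>-island \<open>I\<close>. It is adjacent to the whole path on
  the other side, and fewer than \<open>i\<close> vertices of that path lie outside \<open>I\<close>. Cut the path into \<open>i\<close>
  blocks of \<open>i\<close> consecutive vertices. Some block lies entirely in \<open>I\<close>, and together with \<open>v\<close> it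
  forms a fan on \<open>i + 1\<close> vertices. Hence no \<open>i\<close>-island of \<open>G\<^sub>i\<close> induces a subgraph with
  fan number at most \<open>i\<close> (\<open>island_fan_path_join\<close>). Since every \<open>s\<close>-island with \<open>s \<le> i\<close> is also an
  \<open>i\<close>-island, the graph \<open>G\<^sub>i\<close> itself refutes every candidate \<open>s \<le> i\<close> for its coloring number.
\<close>

section \<open>Bounds on the fan number\<close>

text \<open>In a fan with more than two vertices, the apex and the first two vertices of the path
  form a triangle.\<close>

lemma fan_le_2_if_triangle_free:
  assumes "graph G"
    and triangle_free: "\<And>x y z. x \<rightarrow>\<^bsub>G\<^esub> y \<Longrightarrow> x \<rightarrow>\<^bsub>G\<^esub> z \<Longrightarrow> y \<rightarrow>\<^bsub>G\<^esub> z \<Longrightarrow> False"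
  shows "fan G \<le> 2"
proof -
  have "card (verts F) \<le> 2" if F: "is_fan F" "subgraph F G" for F
  proof -
    from F(1) obtain c p where p: "distinct (c # p)" "verts F = set (c # p)"
      and ends: "set (zip p (tl p)) \<union> {c} \<times> set p \<subseteq> arcs_ends F"
      unfolding is_fan_def by (auto simp: Let_def)
    from F(2) ends have ends: "set (zip p (tl p)) \<union> {c} \<times> set p \<subseteq> arcs_ends G"
      using arcs_ends_mono by blast
    have "length p \<le> 1"
    proof (rule ccontr)
      assume "\<not> length p \<le> 1"
      then obtain x y q where "p = x # y # q"
        by (cases p rule: remdups_adj.cases) auto
      with ends show False using triangle_free[of c x y] by auto
    qed
    with p show ?thesis using distinct_card[of "c # p"] by simp
  qed
  then have "Max {card (verts F) | F. is_fan F \<and> subgraph F G} \<le> 2" if "arcs G \<noteq> {}"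
    using fan_sizes_nonempty[OF assms(1) that]
    by (intro Max.boundedI finite_fan_sizes[OF assms(1)]) blast+
  then show ?thesis unfolding fan_def by simp
qed

lemma length_less_fan:
  assumes "graph G" and p: "p \<noteq> []" "distinct (c # p)"
    and path: "set (zip p (tl p)) \<subseteq> arcs_ends G" and apex: "{c} \<times> set p \<subseteq> arcs_ends G"
  shows "length p < fan G"
proof -
  interpret graph G by fact
  define E where "E = set (zip p (tl p)) \<union> {c} \<times> set p"
  \<comment> \<open>The fan need not be induced, so only the arcs of \<open>G\<close> that belong to it are kept.\<close>
  define F where "F = \<lparr>verts = set (c # p), arcs = {e \<in> arcs G. arc_to_ends G e \<in> E \<union> E\<inverse>},
    tail = tail G, head = head G\<rparr>"
  have E_G: "E \<union> E\<inverse> \<subseteq> arcs_ends G"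
    using path apex sym_arcs unfolding E_def symmetric_def sym_def by blast
  have E_p: "E \<union> E\<inverse> \<subseteq> set (c # p) \<times> set (c # p)"
    using list.set_sel(2)[OF p(1)]
    unfolding E_def by (auto dest: set_zip_leftD set_zip_rightD)
  have ends: "arcs_ends F = E \<union> E\<inverse>"
    using E_G unfolding F_def arcs_ends_def arc_to_ends_def by auto
  have "p \<noteq> []" "hd p \<in> set p" using p by auto
  then have verts_G: "set (c # p) \<subseteq> verts G"
    using apex adj_in_verts by fastforce
  have wf: "wf_digraph F"
    using E_p by unfold_locales (auto simp: F_def arc_to_ends_def)
  have "graph F"
  proof -
    interpret F: wf_digraph F by (rule wf)
    have "sym (arcs_ends F)" unfolding ends by (auto simp: sym_def)
    moreover have "finite (arcs F)" "finite (verts F)" unfolding F_def by auto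
    ultimately show ?thesis
      using no_loops no_multi_arcs
      by unfold_locales (auto simp: F_def symmetric_def arc_to_ends_def)
  qed
  then have "is_fan F"
    unfolding is_fan_def using p ends
    by (intro conjI exI[of _ c] exI[of _ p]) (simp_all add: F_def E_def Let_def)
  moreover have "subgraph F G"
    using wf verts_G wf_digraph by (auto simp: subgraph_def compatible_def F_def)
  ultimately have "card (verts F) \<le> Max {card (verts F) | F. is_fan F \<and> subgraph F G}"
    by (intro Max_ge finite_fan_sizes[OF assms(1)]) auto
  moreover have "card (verts F) = Suc (length p)"
    using distinct_card[OF p(2)] by (simp add: F_def)
  moreover have "verts G \<noteq> {}" "arcs G \<noteq> {}"
    using verts_G apex p(1) by (auto simp: arcs_ends_def neq_Nil_conv)
  ultimately show ?thesis unfolding fan_def by simp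
qed

section \<open>The join of two paths\<close>

text \<open>
  The join of two paths on \<open>n\<close> vertices each. One path consists of the even numbers and the other of
  the odd numbers, so that the side of a vertex is its parity and its position is its half.
\<close>

definition path_join :: "nat \<Rightarrow> (nat, nat \<times> nat) pre_digraph" where
  "path_join n = \<lparr>verts = {..<2 * n},
     arcs = {(u, v). u < 2 * n \<and> v < 2 * n \<and> (odd (u + v) \<or> u = v + 2 \<or> v = u + 2)},
     tail = fst, head = snd\<rparr>"

lemma verts_path_join [simp]: "verts (path_join n) = {..<2 * n}"
  by (simp add: path_join_def)

lemma arcs_ends_path_join:
  "arcs_ends (path_join n) =
     {(u, v). u < 2 * n \<and> v < 2 * n \<and> (odd (u + v) \<or> u = v + 2 \<or> v = u + 2)}"
  by (force simp: path_join_def arcs_ends_def arc_to_ends_def)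

lemma graph_path_join: "graph (path_join n)"
proof -
  have "finite (arcs (path_join n))"
    by (rule finite_subset[of _ "{..<2 * n} \<times> {..<2 * n}"]) (auto simp: path_join_def)
  moreover have "symmetric (path_join n)"
    by (auto simp: symmetric_def sym_def arcs_ends_path_join)
  ultimately show ?thesis
    by unfold_locales (auto simp: path_join_def arc_to_ends_def)
qed

lemma arcs_ends_induce_subgraph:
  "arcs_ends (G \<restriction> S) = {(u, v) \<in> arcs_ends G. u \<in> S \<and> v \<in> S}"
  by (auto simp: arcs_ends_def arc_to_ends_def induce_subgraph_def)

lemma graph_induce_subgraph:
  assumes "graph G" "S \<subseteq> verts G"
  shows "graph (G \<restriction> S)"
proof -
  interpret graph G by fact
  interpret S: digraph "G \<restriction> S"
    using digraph_subgraph induced_imp_subgraph induced_induce[OF assms(2)] by blast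
  have "symmetric (G \<restriction> S)"
    using sym_arcs by (auto simp: symmetric_def sym_def arcs_ends_induce_subgraph)
  then show ?thesis by unfold_locales
qed

section \<open>Coloring from lists of size two\<close>

text \<open>
  Two consecutive vertices of one of the paths differ by two, so coloring the numbers in increasing
  order leaves just one forbidden color for each of them.
\<close>

fun greedy_coloring :: "(nat \<Rightarrow> nat set) \<Rightarrow> nat \<Rightarrow> nat" where
  "greedy_coloring L (Suc (Suc v)) = (SOME c. c \<in> L (Suc (Suc v)) - {greedy_coloring L v})"
| "greedy_coloring L v = (SOME c. c \<in> L v)"

lemma ex_other_color:
  assumes "infinite S \<or> 2 \<le> card S"
  shows "\<exists>c. c \<in> S - {d}"
proof -
  have "\<not> S \<subseteq> {d}"
    using assms card_mono[of "{d}" S] finite_subset[of S "{d}"] by auto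
  then show ?thesis by blast
qed

lemma greedy_coloring:
  assumes "infinite (L v) \<or> 2 \<le> card (L v)"
  shows "greedy_coloring L v \<in> L v"
    and "v = Suc (Suc u) \<Longrightarrow> greedy_coloring L v \<noteq> greedy_coloring L u"
proof -
  note other = someI_ex[OF ex_other_color[OF assms]]
  have "\<exists>c. c \<in> L v" using ex_other_color[OF assms, of 0] by blast
  from someI_ex[OF this] show "greedy_coloring L v \<in> L v"
    using other by (cases "(L, v)" rule: greedy_coloring.cases) auto
  show "v = Suc (Suc u) \<Longrightarrow> greedy_coloring L v \<noteq> greedy_coloring L u"
    using other[of "greedy_coloring L u"] by auto
qed

lemma choice_number_path_join: "choice_number fan 2 (path_join n) \<le> 2"
proof -
  let ?G = "path_join n"
  have "\<exists>\<phi>. list_coloring ?G L \<phi> \<and> proper_wrt fan 2 ?G \<phi>" if L: "list_assignment ?G 2 L" for L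
  proof -
    let ?\<phi> = "greedy_coloring L"
    from L have L: "infinite (L v) \<or> 2 \<le> card (L v)" if "v < 2 * n" for v
      using that by (auto simp: list_assignment_def)
    have path_edge: "?\<phi> v \<noteq> ?\<phi> u"
      if "u < 2 * n" "v < 2 * n" "odd (u + v) \<or> u = v + 2 \<or> v = u + 2" "even (u + v)" for u v
      using greedy_coloring(2)[of L v u, OF L[OF that(2)]]
        greedy_coloring(2)[of L u v, OF L[OF that(1)]] that(3,4)
      unfolding add_2_eq_Suc' by metis
    have "fan (?G \<restriction> {v \<in> verts ?G. ?\<phi> v = c}) \<le> 2" for c
    proof (rule fan_le_2_if_triangle_free)
      show "graph (?G \<restriction> {v \<in> verts ?G. ?\<phi> v = c})"
        by (rule graph_induce_subgraph[OF graph_path_join]) auto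
    next
      fix x y z
      assume "x \<rightarrow>\<^bsub>?G \<restriction> {v \<in> verts ?G. ?\<phi> v = c}\<^esub> y" "x \<rightarrow>\<^bsub>?G \<restriction> {v \<in> verts ?G. ?\<phi> v = c}\<^esub> z"
        "y \<rightarrow>\<^bsub>?G \<restriction> {v \<in> verts ?G. ?\<phi> v = c}\<^esub> z"
      then have *: "x < 2 * n" "y < 2 * n" "z < 2 * n" "?\<phi> x = ?\<phi> y" "?\<phi> x = ?\<phi> z"
        "odd (x + y) \<or> x = y + 2 \<or> y = x + 2" "odd (x + z) \<or> x = z + 2 \<or> z = x + 2"
        "odd (y + z) \<or> y = z + 2 \<or> z = y + 2"
        by (simp_all only: arcs_ends_induce_subgraph arcs_ends_path_join mem_Collect_eq prod.case)
      \<comment> \<open>Two of the three vertices have the same parity.\<close>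
      consider "even (x + y)" | "even (x + z)" | "even (y + z)" by (meson even_add)
      then show False
      proof cases
        case 1 with path_edge[OF *(1,2,6)] *(4,5) show False by simp
      next
        case 2 with path_edge[OF *(1,3,7)] *(4,5) show False by simp
      next
        case 3 with path_edge[OF *(2,3,8)] *(4,5) show False by simp
      qed
    qed
    moreover have "list_coloring ?G L ?\<phi>"
      using greedy_coloring(1)[OF L] by (auto simp: list_coloring_def)
    ultimately show ?thesis unfolding proper_wrt_def by blast
  qed
  then have "choice_number fan 2 ?G \<le> enat 2"
    unfolding choice_number_def by (intro Inf_lower) blast
  then show ?thesis by (simp add: numeral_eq_enat)
qed

section \<open>Islands contain large fans\<close>

text \<open>Fewer than \<open>m\<close> missing points cannot meet all of \<open>m\<close> disjoint sets.\<close>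

lemma ex_subset_of_disjoint_family:
  assumes "disjoint_family_on B {..<m}" and "finite A" and "\<And>b. b < m \<Longrightarrow> B b \<subseteq> A"
    and "card (A - I) < m"
  shows "\<exists>b<m. B b \<subseteq> I"
proof (rule ccontr)
  assume "\<not> ?thesis"
  then have "\<forall>b. \<exists>w. b < m \<longrightarrow> w \<in> B b - I" by blast
  from choice[OF this] obtain g where g: "g b \<in> B b" "g b \<notin> I" if "b < m" for b
    by blast
  have "inj_on g {..<m}"
  proof (rule inj_onI)
    fix b c assume bc: "b \<in> {..<m}" "c \<in> {..<m}" "g b = g c"
    with g(1)[of b] g(1)[of c] have "B b \<inter> B c \<noteq> {}" by auto
    with assms(1) bc show "b = c" unfolding disjoint_family_on_def by blast
  qed
  moreover have "g ` {..<m} \<subseteq> A - I"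
    using g assms(3) by blast
  ultimately have "m \<le> card (A - I)"
    using card_inj_on_le[of g "{..<m}" "A - I"] assms(2) by simp
  with assms(4) show False by simp
qed

text \<open>
  A block of the path of parity \<open>r\<close>; the \<open>i\<close> blocks with \<open>b < i\<close> partition that path in
  \<open>path_join (i * i)\<close>.
\<close>

definition block :: "nat \<Rightarrow> nat \<Rightarrow> nat \<Rightarrow> nat list" where
  "block i r b = map (\<lambda>j. 2 * (i * b + j) + r) [0..<i]"

lemma set_block_div:
  assumes "w \<in> set (block i r b)" "r < 2"
  shows "w div 2 div i = b" and "w mod 2 = r"
proof -
  from assms(1) obtain j where j: "j < i" and w: "w = 2 * (i * b + j) + r"
    by (auto simp: block_def)
  from w assms(2) have "w div 2 = i * b + j" and "w mod 2 = r" by presburger+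
  with j show "w div 2 div i = b" "w mod 2 = r" by auto
qed

lemma set_block_less:
  assumes "w \<in> set (block i r b)" "r < 2" "b < i"
  shows "w < 2 * (i * i)"
proof -
  from assms(1) have "i > 0" by (auto simp: block_def)
  have "w div 2 < i * i"
    using set_block_div(1)[OF assms(1,2)] assms(3) \<open>i > 0\<close>
    by (simp add: div_less_iff_less_mult[symmetric])
  then show ?thesis by linarith
qed

lemma zip_block:
  assumes "(x, y) \<in> set (zip (block i r b) (tl (block i r b)))"
  shows "y = x + 2"
  using assms by (auto simp: block_def in_set_zip nth_tl)

lemma island_fan_path_join:
  assumes "island i (path_join (i * i)) I"
  shows "i < fan (path_join (i * i) \<restriction> I)"
proof -
  let ?G = "path_join (i * i)"
  from assms obtain v where v: "v \<in> I" and I: "I \<subseteq> verts ?G"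
    and few: "card {w \<in> verts ?G - I. v \<rightarrow>\<^bsub>?G\<^esub> w} < i"
    unfolding island_def by blast
  then have "i > 0" and v_less: "v < 2 * (i * i)" by auto
  \<comment> \<open>The parity of the side opposite to \<open>v\<close>.\<close>
  define r where "r = (v + 1) mod 2"
  have r: "r < 2" "odd (v + w) \<longleftrightarrow> w mod 2 = r" for w
    unfolding r_def by presburger+
  let ?A = "{w \<in> verts ?G. w mod 2 = r}"
  have "?A - I \<subseteq> {w \<in> verts ?G - I. v \<rightarrow>\<^bsub>?G\<^esub> w}"
    using v_less r(2) by (auto simp: arcs_ends_path_join)
  then have "card (?A - I) < i"
    by (intro le_less_trans[OF card_mono few]) auto
  moreover have "set (block i r b) \<subseteq> ?A" if "b < i" for b
    using set_block_div(2)[OF _ r(1)] set_block_less[OF _ r(1) that] by auto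
  moreover have "disjoint_family_on (\<lambda>b. set (block i r b)) {..<i}"
    using set_block_div(1)[OF _ r(1)] unfolding disjoint_family_on_def disjoint_iff by metis
  ultimately obtain b where b: "b < i" "set (block i r b) \<subseteq> I"
    using ex_subset_of_disjoint_family[of "\<lambda>b. set (block i r b)" i ?A I] by auto
  have less: "w < 2 * (i * i)" "odd (v + w)" if "w \<in> set (block i r b)" for w
    using that set_block_less[OF _ r(1) b(1)] set_block_div(2)[OF _ r(1)] r(2) by auto
  have "length (block i r b) < fan (?G \<restriction> I)"
  proof (rule length_less_fan)
    show "graph (?G \<restriction> I)"
      using I by (rule graph_induce_subgraph[OF graph_path_join])
    show ne: "block i r b \<noteq> []" using \<open>i > 0\<close> by (simp add: block_def)
    have "v \<notin> set (block i r b)" using less(2)[of v] by auto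
    then show "distinct (v # block i r b)"
      by (simp add: block_def distinct_map inj_on_def)
    show "{v} \<times> set (block i r b) \<subseteq> arcs_ends (?G \<restriction> I)"
      using v v_less b(2) less by (auto simp: arcs_ends_induce_subgraph arcs_ends_path_join)
    show "set (zip (block i r b) (tl (block i r b))) \<subseteq> arcs_ends (?G \<restriction> I)"
    proof clarify
      fix x y assume xy: "(x, y) \<in> set (zip (block i r b) (tl (block i r b)))"
      then have "x \<in> set (block i r b)" "y \<in> set (block i r b)"
        using list.set_sel(2)[OF ne] by (blast dest: set_zip_leftD set_zip_rightD)+
      then show "(x, y) \<in> arcs_ends (?G \<restriction> I)"
        using b(2) less(1) zip_block[OF xy]
        by (auto simp: arcs_ends_induce_subgraph arcs_ends_path_join)
    qed
  qed
  then show ?thesis by (simp add: block_def)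
qed

lemma coloring_number_path_join:
  assumes "0 < i"
  shows "enat (i + 1) \<le> coloring_number fan i (path_join (i * i))"
proof -
  let ?G = "path_join (i * i)"
  interpret graph ?G by (rule graph_path_join)
  have "i < s" if islands: "\<forall>H. induced_subgraph H ?G \<and> verts H \<noteq> {} \<longrightarrow>
                      (\<exists>I. island s H I \<and> fan (H \<restriction> I) \<le> i)" for s
  proof (rule ccontr)
    assume "\<not> i < s"
    from assms have "0 \<in> verts ?G" by simp
    then have "verts ?G \<noteq> {}" by blast
    moreover have "induced_subgraph ?G ?G" by (rule induced_subgraph_refl)
    ultimately obtain I where I: "island s ?G I" "fan (?G \<restriction> I) \<le> i"
      using islands by blast
    then have "island i ?G I"
      using \<open>\<not> i < s\<close> unfolding island_def by fastforce
    then show False using island_fan_path_join[of i I] I(2) by simp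
  qed
  then show ?thesis
    unfolding coloring_number_def by (intro Inf_greatest) (auto simp: Suc_le_eq)
qed

theorem lemma2:
  shows "\<exists>G :: nat \<Rightarrow> (nat, nat \<times> nat) pre_digraph.
    (\<forall>i. graph (G i)) \<and>
    (\<forall>i>0. choice_number fan 2 (G i) \<le> 2 \<and> enat (i + 1) \<le> coloring_number fan i (G i))"
proof (intro exI conjI allI impI)
  fix i :: nat
  show "graph (path_join (i * i))" by (rule graph_path_join)
  show "choice_number fan 2 (path_join (i * i)) \<le> 2" by (rule choice_number_path_join)
  assume "0 < i"
  then show "enat (i + 1) \<le> coloring_number fan i (path_join (i * i))"
    by (rule coloring_number_path_join)
qed

end
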